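(* Let $\mathcal M,\mathcal N$ be $C^2$-manifolds of dimensions $m,n$, let $\mathcal K\subset\mathcal N$ be a submanifold with corners of dimension $k$, let $f\in C^2(\mathcal M,\mathbb R)$, $g\in C^2(\mathcal M,\mathcal N)$, and $\mathcal F=\{p\in\mathcal M : g(p)\in\mathcal K\}$. Assume that $p_*\in\mathcal F$ and $\mu\in T^*_{g(p_* )}\mathcal N$ satisfy the KKT conditions $$f'(p_* )+\mu\,g'(p_* )=0\ \text{ in }T^*_{p_*}\mathcal M,\qquad \mu\in\bigl(T^i_{g(p_* )}\mathcal K\bigr)^\circ,$$ and that $$L''(p_*,\mu)[v,v]>0\quad\text{for all }v\in C_{\mathcal M}\setminus\{0_{p_*}\},$$ where $C_{\mathcal M}=\{v\in T_{p_*}\mathcal M : g'(p_* )v\in T^i_{g(p_* )}\mathcal K,\ f'(p_* )v=0\}$. Then $p_*$ is a strict local minimizer of $f$ over $\mathcal F$.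
   Context: Manifolds are finite-dimensional and without boundary. A subset $\mathcal K\subset\mathcal N$ is a submanifold with corners of dimension $k$ ($0\le k\le n$) if for each $q\in\mathcal K$ there are a chart $(\mathcal U,\psi)$ of $\mathcal N$ with $q\in\mathcal U$, $\psi(q)=0$, an integer $0\le\ell\le k$, and a surjective linear map $A:\mathbb R^k\times\{0\}^{n-k}\to\mathbb R^\ell$ such that $\psi(\mathcal K\cap\mathcal U)=\{x\in\psi(\mathcal U) : Wx=0,\ Ax\le 0\}$, where $Wx=(x_{k+1},\dots,x_n)^{\mathsf T}$ and $\le$ is componentwise. Such a chart is called an adapted chart centered at $q$; $A$ is identified with the matrix $[\widehat A\ \ 0]\in\mathbb R^{\ell\times n}$. With $v_\psi$ the representative of $v\in T_q\mathcal N$ in an adapted chart $\psi$ centered at $q\in\mathcal K$, $T^i_q\mathcal K=\{v\in T_q\mathcal N : Wv_\psi=0,\ Av_\psi\le0\}$ (independent of the adapted chart). The polar cone of $S\subset V$ is $S^\circ=\{v^*\in V^*:\langle v^*,s\rangle\le0\ \forall s\in S\}$. A linearizing map at $q\in\mathcal N$ is a $C^2$-map $S_q:\mathcal U_q\to T_q\mathcal N$ on an open neighborhood $\mathcal U_q$ of $q$ with $S_q(q)=0_q$ and $DS_q(q)=\mathrm{id}_{T_q\mathcal N}$; it is adapted to $\mathcal K$ if $S_q(\mathcal U_q\cap\mathcal K)=S_q(\mathcal U_q)\cap T^i_q\mathcal K$. Adapted linearizing maps are assumed injective (on a sufficiently small domain). Definition of $L''(p_*,\mu)$ on $C_{\mathcal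 M}$: with $q_*=g(p_* )$ and any adapted linearizing map $S_{q_*}$ at $q_*$, let $L_{S_{q_*}}(p,\mu)=f(p)+\mu(S_{q_*}(g(p)))$ for $p$ near $p_*$; the KKT conditions make $p_*$ a stationary point of this function of $p$, and $L''(p_*,\mu)[v,v]:=L_{S_{q_*}}''(p_*,\mu)[v,v]$, the second derivative in $p$ computed in any chart $\varphi$ around $p_*$ (i.e. $\sigma''(p_* )[v,v]=(\sigma\circ\varphi^{-1})''(\varphi(p_* ))[v_\varphi,v_\varphi]$ for $\sigma=L_{S_{q_*}}(\cdot,\mu)$). For $v\in C_{\mathcal M}$ this value is independent of $\varphi$ and of the adapted linearizing map $S_{q_*}$. *)

theory Defs
  imports "HOL-Analysis.Analysis"
begin

text \<open>Twice continuously differentiable maps; only meant for open \<open>S\<close>.\<close>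

definition C2_on :: "'d::real_normed_vector set \<Rightarrow> ('d \<Rightarrow> 'e::real_normed_vector) \<Rightarrow> bool" where
  "C2_on S F \<longleftrightarrow>
     (\<exists>(F' :: 'd \<Rightarrow> 'd \<Rightarrow>\<^sub>L 'e) (F'' :: 'd \<Rightarrow> 'd \<Rightarrow>\<^sub>L 'd \<Rightarrow>\<^sub>L 'e).
        (\<forall>x\<in>S. (F has_derivative blinfun_apply (F' x)) (at x)) \<and>
        (\<forall>x\<in>S. (F' has_derivative blinfun_apply (F'' x)) (at x)) \<and>
        continuous_on S F'')"

text \<open>
  A chart is a pair of its domain and its coordinate map; values of the map outside
  the domain are irrelevant.
\<close>

type_synonym ('a, 'e) chart = "'a set \<times> ('a \<Rightarrow> 'e)"

definition chart_inv :: "('a, 'e) chart \<Rightarrow> 'e \<Rightarrow> 'a" where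
  "chart_inv c = inv_into (fst c) (snd c)"

definition topological_chart ::
    "('a::topological_space, 'e::real_normed_vector) chart \<Rightarrow> bool" where
  "topological_chart c \<longleftrightarrow> open (fst c) \<and> open (snd c ` fst c) \<and>
     homeomorphism (fst c) (snd c ` fst c) (snd c) (chart_inv c)"

definition C2_compatible ::
    "('a, 'e::real_normed_vector) chart \<Rightarrow> ('a, 'e) chart \<Rightarrow> bool" where
  "C2_compatible c d \<longleftrightarrow>
     C2_on (snd c ` (fst c \<inter> fst d)) (snd d \<circ> chart_inv c) \<and>
     C2_on (snd d ` (fst c \<inter> fst d)) (snd c \<circ> chart_inv d)"

text \<open>
  A manifold lives on a whole (Hausdorff, second countable) type \<open>'a\<close>. Its model space
  \<open>\<real>\<^sup>n\<close> is a real inner product space \<open>'e\<close> together with an orthonormal basis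
  \<open>frame 0, \<dots>, frame (n - 1)\<close>, where \<open>n = mdim\<close>; the class \<open>euclidean_space\<close> is not used
  because it excludes \<open>n = 0\<close> and its basis is not ordered. Values \<open>frame i\<close> with
  \<open>n \<le> i\<close> are irrelevant. The field \<open>charts\<close> is the maximal atlas.
\<close>

record ('a, 'e) manifold =
  mdim :: nat
  frame :: "nat \<Rightarrow> 'e"
  charts :: "('a, 'e) chart set"

definition C2_manifold ::
    "('a::{t2_space,second_countable_topology}, 'e::real_inner) manifold \<Rightarrow> bool" where
  "C2_manifold M \<longleftrightarrow>
     (\<forall>i<mdim M. \<forall>j<mdim M. frame M i \<bullet> frame M j = (if i = j then 1 else 0)) \<and>
     span (frame M ` {..<mdim M}) = UNIV \<and>
     (\<forall>c\<in>charts M. topological_chart c) \<and>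
     (\<Union>c\<in>charts M. fst c) = UNIV \<and>
     (\<forall>c\<in>charts M. \<forall>d\<in>charts M. C2_compatible c d) \<and>
     (\<forall>c. topological_chart c \<and> (\<forall>d\<in>charts M. C2_compatible c d) \<longrightarrow> c \<in> charts M)"

definition charts_at :: "('a, 'e) manifold \<Rightarrow> 'a \<Rightarrow> ('a, 'e) chart set" where
  "charts_at M p = {c \<in> charts M. p \<in> fst c}"

definition chart_at :: "('a, 'e) manifold \<Rightarrow> 'a \<Rightarrow> ('a, 'e) chart" where
  "chart_at M p = (SOME c. c \<in> charts_at M p)"

text \<open>
  A tangent vector at \<open>p\<close> is the family of its representatives \<open>v c\<close> in the charts \<open>c\<close>
  around \<open>p\<close>, related by the derivatives of the chart changes, and \<open>0\<close> at all other
  charts. The vector space operations are pointwise.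
\<close>

type_synonym ('a, 'e) tangent = "('a, 'e) chart \<Rightarrow> 'e"

definition tangent_space ::
    "('a, 'e::real_normed_vector) manifold \<Rightarrow> 'a \<Rightarrow> ('a, 'e) tangent set" where
  "tangent_space M p = {v.
     (\<forall>c. c \<notin> charts_at M p \<longrightarrow> v c = 0) \<and>
     (\<forall>c\<in>charts_at M p. \<forall>d\<in>charts_at M p.
        v d = frechet_derivative (snd d \<circ> chart_inv c) (at (snd c p)) (v c))}"

text \<open>Values of a cotangent vector outside the tangent space are irrelevant.\<close>

definition cotangent_space ::
    "('a, 'e::real_normed_vector) manifold \<Rightarrow> 'a \<Rightarrow> (('a, 'e) tangent \<Rightarrow> real) set" where
  "cotangent_space M p = {\<mu>.
     (\<forall>u\<in>tangent_space M p. \<forall>v\<in>tangent_space M p. \<mu> (\<lambda>c. u c + v c) = \<mu> u + \<mu> v) \<and>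
     (\<forall>a. \<forall>v\<in>tangent_space M p. \<mu> (\<lambda>c. a *\<^sub>R v c) = a * \<mu> v)}"

definition polar_cone ::
    "('a, 'e::real_normed_vector) manifold \<Rightarrow> 'a \<Rightarrow> ('a, 'e) tangent set
     \<Rightarrow> (('a, 'e) tangent \<Rightarrow> real) set" where
  "polar_cone M p T = {\<mu> \<in> cotangent_space M p. \<forall>s\<in>T. \<mu> s \<le> 0}"

definition C2_function :: "('a, 'e::real_normed_vector) manifold \<Rightarrow> ('a \<Rightarrow> real) \<Rightarrow> bool" where
  "C2_function M f \<longleftrightarrow> (\<forall>c\<in>charts M. C2_on (snd c ` fst c) (f \<circ> chart_inv c))"

definition C2_map ::
    "('a::topological_space, 'd::real_normed_vector) manifold
     \<Rightarrow> ('b::topological_space, 'e::real_normed_vector) manifold \<Rightarrow> ('a \<Rightarrow> 'b) \<Rightarrow> bool" where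
  "C2_map M N g \<longleftrightarrow> continuous_on UNIV g \<and>
     (\<forall>c\<in>charts M. \<forall>d\<in>charts N.
        C2_on (snd c ` (fst c \<inter> g -` fst d)) (snd d \<circ> g \<circ> chart_inv c))"

text \<open>
  The differentials of a function and of a map, for tangent vectors \<open>v\<close> at \<open>p\<close>. By the
  chain rule they do not depend on the chart around \<open>p\<close> selected by \<open>chart_at\<close>.
\<close>

definition deriv_function ::
    "('a, 'e::real_normed_vector) manifold \<Rightarrow> ('a \<Rightarrow> real) \<Rightarrow> 'a \<Rightarrow> ('a, 'e) tangent \<Rightarrow> real" where
  "deriv_function M f p v =
     (let c = chart_at M p in frechet_derivative (f \<circ> chart_inv c) (at (snd c p)) (v c))"

definition deriv_map ::
    "('a, 'd::real_normed_vector) manifold \<Rightarrow> ('b, 'e::real_normed_vector) manifold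
     \<Rightarrow> ('a \<Rightarrow> 'b) \<Rightarrow> 'a \<Rightarrow> ('a, 'd) tangent \<Rightarrow> ('b, 'e) tangent" where
  "deriv_map M N g p v =
     (let c = chart_at M p in
      (\<lambda>d. if d \<in> charts_at N (g p)
           then frechet_derivative (snd d \<circ> g \<circ> chart_inv c) (at (snd c p)) (v c)
           else 0))"

text \<open>
  Coordinates and matrix entries are indexed from \<open>0\<close>: \<open>coord N i x\<close> is \<open>x\<^sub>i\<^sub>+\<^sub>1\<close>, so that
  \<open>W x = 0\<close> concerns the indices \<open>k \<le> i < n\<close>. A linear map from
  \<open>\<real>\<^sup>k \<times> {0}\<close> to \<open>\<real>\<^sup>l\<close> is given by the entries \<open>A j i\<close>, \<open>j < l\<close>, \<open>i < k\<close>, of its matrix;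
  the columns with \<open>k \<le> i\<close> count as zero.
\<close>

definition coord :: "('a, 'e::real_inner) manifold \<Rightarrow> nat \<Rightarrow> 'e \<Rightarrow> real" where
  "coord N i x = x \<bullet> frame N i"

definition surjective_matrix :: "nat \<Rightarrow> nat \<Rightarrow> (nat \<Rightarrow> nat \<Rightarrow> real) \<Rightarrow> bool" where
  "surjective_matrix l k A \<longleftrightarrow>
     (\<forall>y :: nat \<Rightarrow> real. \<exists>x :: nat \<Rightarrow> real. \<forall>j<l. (\<Sum>i<k. A j i * x i) = y j)"

definition corner_cone ::
    "('a, 'e::real_inner) manifold \<Rightarrow> nat \<Rightarrow> nat \<Rightarrow> (nat \<Rightarrow> nat \<Rightarrow> real) \<Rightarrow> 'e set" where
  "corner_cone N k l A = {x.
     (\<forall>i\<in>{k..<mdim N}. coord N i x = 0) \<and>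
     (\<forall>j<l. (\<Sum>i<k. A j i * coord N i x) \<le> 0)}"

definition adapted_chart ::
    "('a, 'e::real_inner) manifold \<Rightarrow> nat \<Rightarrow> 'a set \<Rightarrow> 'a
     \<Rightarrow> ('a, 'e) chart \<Rightarrow> nat \<Rightarrow> (nat \<Rightarrow> nat \<Rightarrow> real) \<Rightarrow> bool" where
  "adapted_chart N k K q c l A \<longleftrightarrow>
     c \<in> charts_at N q \<and> snd c q = 0 \<and> l \<le> k \<and> surjective_matrix l k A \<and>
     snd c ` (K \<inter> fst c) = {x \<in> snd c ` fst c. x \<in> corner_cone N k l A}"

definition submanifold_with_corners ::
    "('a, 'e::real_inner) manifold \<Rightarrow> nat \<Rightarrow> 'a set \<Rightarrow> bool" where
  "submanifold_with_corners N k K \<longleftrightarrow>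
     k \<le> mdim N \<and> (\<forall>q\<in>K. \<exists>c l A. adapted_chart N k K q c l A)"

text \<open>
  The inner tangent cone. The condition holds for one adapted chart centered at \<open>q\<close>
  if and only if it holds for all of them.
\<close>

definition inner_tangent_cone ::
    "('a, 'e::real_inner) manifold \<Rightarrow> nat \<Rightarrow> 'a set \<Rightarrow> 'a \<Rightarrow> ('a, 'e) tangent set" where
  "inner_tangent_cone N k K q = {v \<in> tangent_space N q.
     \<exists>c l A. adapted_chart N k K q c l A \<and> v c \<in> corner_cone N k l A}"

text \<open>
  Smoothness and the derivative of a map into \<open>tangent_space N q\<close> are those of its
  representatives: \<open>c\<close> identifies the tangent space linearly with the model space, and
  \<open>d\<close> is the chart for the argument.
\<close>

definition linearizing_map ::
    "('a::topological_space, 'e::real_normed_vector) manifold \<Rightarrow> 'a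
     \<Rightarrow> 'a set \<Rightarrow> ('a \<Rightarrow> ('a, 'e) tangent) \<Rightarrow> bool" where
  "linearizing_map N q U S \<longleftrightarrow>
     open U \<and> q \<in> U \<and> S ` U \<subseteq> tangent_space N q \<and>
     (\<forall>c\<in>charts_at N q. \<forall>d\<in>charts N.
        C2_on (snd d ` (fst d \<inter> U)) (\<lambda>x. S (chart_inv d x) c)) \<and>
     S q = (\<lambda>c. 0) \<and>
     (\<forall>c\<in>charts_at N q. \<forall>d\<in>charts_at N q. \<forall>v\<in>tangent_space N q.
        frechet_derivative (\<lambda>x. S (chart_inv d x) c) (at (snd d q)) (v d) = v c)"

definition adapted_linearizing_map ::
    "('a::topological_space, 'e::real_inner) manifold \<Rightarrow> nat \<Rightarrow> 'a set \<Rightarrow> 'a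
     \<Rightarrow> 'a set \<Rightarrow> ('a \<Rightarrow> ('a, 'e) tangent) \<Rightarrow> bool" where
  "adapted_linearizing_map N k K q U S \<longleftrightarrow>
     linearizing_map N q U S \<and> inj_on S U \<and>
     S ` (U \<inter> K) = S ` U \<inter> inner_tangent_cone N k K q"

definition second_deriv_function ::
    "('a, 'e::real_normed_vector) manifold \<Rightarrow> ('a \<Rightarrow> real) \<Rightarrow> 'a \<Rightarrow> ('a, 'e) tangent \<Rightarrow> real" where
  "second_deriv_function M \<sigma> p v =
     (let c = chart_at M p in
      frechet_derivative
        (\<lambda>x. frechet_derivative (\<sigma> \<circ> chart_inv c) (at x) (v c)) (at (snd c p)) (v c))"

text \<open>
  The number \<open>L''(p, \<mu>)[v, v]\<close>. At a KKT point and for \<open>v\<close> in the critical cone it does not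
  depend on the adapted linearizing map and the chart used to compute it, so any choice
  can be made.
\<close>

definition lagrangian ::
    "('a \<Rightarrow> real) \<Rightarrow> ('a \<Rightarrow> 'b) \<Rightarrow> (('b, 'e) tangent \<Rightarrow> real) \<Rightarrow> ('b \<Rightarrow> ('b, 'e) tangent)
     \<Rightarrow> 'a \<Rightarrow> real" where
  "lagrangian f g \<mu> S p = f p + \<mu> (S (g p))"

definition some_adapted_linearizing_map ::
    "('a::topological_space, 'e::real_inner) manifold \<Rightarrow> nat \<Rightarrow> 'a set \<Rightarrow> 'a
     \<Rightarrow> 'a \<Rightarrow> ('a, 'e) tangent" where
  "some_adapted_linearizing_map N k K q =
     (SOME S. \<exists>U. adapted_linearizing_map N k K q U S)"

definition lagrangian_second_deriv ::
    "('a, 'd::real_normed_vector) manifold \<Rightarrow> ('b::topological_space, 'e::real_inner) manifold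
     \<Rightarrow> nat \<Rightarrow> 'b set \<Rightarrow> ('a \<Rightarrow> real) \<Rightarrow> ('a \<Rightarrow> 'b) \<Rightarrow> 'a \<Rightarrow> (('b, 'e) tangent \<Rightarrow> real)
     \<Rightarrow> ('a, 'd) tangent \<Rightarrow> real" where
  "lagrangian_second_deriv M N k K f g p \<mu> v =
     second_deriv_function M
       (lagrangian f g \<mu> (some_adapted_linearizing_map N k K (g p))) p v"

definition KKT_point ::
    "('a, 'd::real_normed_vector) manifold \<Rightarrow> ('b, 'e::real_inner) manifold
     \<Rightarrow> nat \<Rightarrow> 'b set \<Rightarrow> ('a \<Rightarrow> real) \<Rightarrow> ('a \<Rightarrow> 'b) \<Rightarrow> 'a \<Rightarrow> (('b, 'e) tangent \<Rightarrow> real) \<Rightarrow> bool" where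
  "KKT_point M N k K f g p \<mu> \<longleftrightarrow>
     (\<forall>v\<in>tangent_space M p. deriv_function M f p v + \<mu> (deriv_map M N g p v) = 0) \<and>
     \<mu> \<in> polar_cone N (g p) (inner_tangent_cone N k K (g p))"

definition critical_cone ::
    "('a, 'd::real_normed_vector) manifold \<Rightarrow> ('b, 'e::real_inner) manifold
     \<Rightarrow> nat \<Rightarrow> 'b set \<Rightarrow> ('a \<Rightarrow> real) \<Rightarrow> ('a \<Rightarrow> 'b) \<Rightarrow> 'a \<Rightarrow> ('a, 'd) tangent set" where
  "critical_cone M N k K f g p = {v \<in> tangent_space M p.
     deriv_map M N g p v \<in> inner_tangent_cone N k K (g p) \<and> deriv_function M f p v = 0}"

definition strict_local_minimizer ::
    "('a::topological_space \<Rightarrow> real) \<Rightarrow> 'a set \<Rightarrow> 'a \<Rightarrow> bool" where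
  "strict_local_minimizer f F p \<longleftrightarrow>
     p \<in> F \<and> (\<exists>U. open U \<and> p \<in> U \<and> (\<forall>x\<in>U \<inter> F. x \<noteq> p \<longrightarrow> f p < f x))"

end

theory Submission
  imports Defs
begin

text \<open>
  Suppose that points \<open>x\<^sub>n \<noteq> p\<close> of \<open>F\<close> converge to \<open>p\<close> with \<open>f x\<^sub>n \<le> f p\<close>. In a chart, a
  subsequence of their directions from \<open>p\<close> converges to the representative of some \<open>v \<noteq> 0\<close>.
  For an adapted linearizing map \<open>S\<close> at \<open>g p\<close>, the vectors \<open>S (g x\<^sub>n)\<close> lie in the inner
  tangent cone; the cone is closed and the rescaled vectors converge to \<open>g'(p) v\<close>, so that
  \<open>v\<close> belongs to the critical cone by the KKT conditions. The polarity of \<open>\<mu>\<close> gives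
  \<open>\<mu> (S (g x\<^sub>n)) \<le> 0\<close>, so the Lagrangian does not exceed its value at \<open>p\<close> along \<open>x\<^sub>n\<close>.
  As \<open>p\<close> is a stationary point of the Lagrangian, its second derivative in direction \<open>v\<close>
  is then nonpositive, a contradiction.
\<close>

section \<open>Twice continuously differentiable maps\<close>

lemma C2_on_subset: "C2_on S F \<Longrightarrow> T \<subseteq> S \<Longrightarrow> C2_on T F"
  unfolding C2_on_def by (meson continuous_on_subset subsetD)

lemma C2_on_imp_has_derivative:
  assumes "C2_on S F" "x \<in> S"
  shows "(F has_derivative frechet_derivative F (at x)) (at x)"
  using assms unfolding C2_on_def by (metis differentiableI frechet_derivative_works)

lemma C2_on_cong:
  assumes "C2_on S F" "open S" "\<And>x. x \<in> S \<Longrightarrow> F x = G x"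
  shows "C2_on S G"
proof -
  have "(G has_derivative D) (at x)" if "(F has_derivative D) (at x)" "x \<in> S" for x D
    using has_derivative_transform_within_open[OF that(1) assms(2) that(2) assms(3)] .
  then show ?thesis using assms(1) unfolding C2_on_def by blast
qed

lemma C2_on_add:
  assumes "C2_on S F" "C2_on S G"
  shows "C2_on S (\<lambda>x. F x + G x)"
proof -
  obtain F' F'' G' G'' where
    F: "\<And>x. x\<in>S \<Longrightarrow> (F has_derivative blinfun_apply (F' x)) (at x)"
       "\<And>x. x\<in>S \<Longrightarrow> (F' has_derivative blinfun_apply (F'' x)) (at x)" "continuous_on S F''"
    and G: "\<And>x. x\<in>S \<Longrightarrow> (G has_derivative blinfun_apply (G' x)) (at x)"
       "\<And>x. x\<in>S \<Longrightarrow> (G' has_derivative blinfun_apply (G'' x)) (at x)" "continuous_on S G''"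
    using assms unfolding C2_on_def by metis
  show ?thesis
    unfolding C2_on_def
    using F G
    by (intro exI[of _ "\<lambda>x. F' x + G' x"] exI[of _ "\<lambda>x. F'' x + G'' x"])
       (auto simp: plus_blinfun.rep_eq intro!: has_derivative_add continuous_on_add)
qed

lemma C2_on_bounded_linear:
  assumes "bounded_linear L"
  shows "C2_on S L"
  unfolding C2_on_def
  by (intro exI[of _ "\<lambda>x. Blinfun L"] exI[of _ "\<lambda>x. 0"])
     (auto simp: bounded_linear_Blinfun_apply assms zero_blinfun.rep_eq
       intro: bounded_linear_imp_has_derivative)

text \<open>The chain rule gives the first derivative \<open>G' (F x) o\<^sub>L F' x\<close>; the
  product rule for operator composition, together with the chain rule for \<open>G'\<close>,
  differentiates it once more.\<close>

lemma C2_on_compose: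
  fixes F :: "'a::real_normed_vector \<Rightarrow> 'b::real_normed_vector"
    and G :: "'b \<Rightarrow> 'c::real_normed_vector"
  assumes "C2_on S F" "C2_on T G" "F ` S \<subseteq> T"
  shows "C2_on S (G \<circ> F)"
proof -
  obtain F' F'' G' G'' where
    F: "\<And>x. x\<in>S \<Longrightarrow> (F has_derivative blinfun_apply (F' x)) (at x)"
       "\<And>x. x\<in>S \<Longrightarrow> (F' has_derivative blinfun_apply (F'' x)) (at x)" "continuous_on S F''"
    and G: "\<And>x. x\<in>T \<Longrightarrow> (G has_derivative blinfun_apply (G' x)) (at x)"
       "\<And>x. x\<in>T \<Longrightarrow> (G' has_derivative blinfun_apply (G'' x)) (at x)" "continuous_on T G''"
    using assms unfolding C2_on_def by metis
  have FS: "F x \<in> T" if "x \<in> S" for x using that assms(3) by blast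
  note bb = bounded_bilinear_blinfun_compose
  \<comment> \<open>\<open>lc a\<close> composes with \<open>a\<close> on the left,
    \<open>rc b\<close> with \<open>b\<close> on the right. As bounded linear operators they make
    both product rule summands bounded linear maps depending continuously on the point.\<close>
  define lc :: "('b \<Rightarrow>\<^sub>L 'c) \<Rightarrow> ('a \<Rightarrow>\<^sub>L 'b) \<Rightarrow>\<^sub>L ('a \<Rightarrow>\<^sub>L 'c)"
    where "lc = bounded_bilinear.prod_right (o\<^sub>L)"
  define rc :: "('a \<Rightarrow>\<^sub>L 'b) \<Rightarrow> ('b \<Rightarrow>\<^sub>L 'c) \<Rightarrow>\<^sub>L ('a \<Rightarrow>\<^sub>L 'c)"
    where "rc = bounded_bilinear.prod_left (o\<^sub>L)"
  have lc: "bounded_linear lc" "\<And>a b. lc a b = a o\<^sub>L b"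
    unfolding lc_def
    using bounded_bilinear.bounded_linear_prod_right[OF bb] by (auto simp: bounded_bilinear.prod_right.rep_eq[OF bb])
  have rc: "bounded_linear rc" "\<And>a b. rc a b = b o\<^sub>L a"
    unfolding rc_def
    using bounded_bilinear.bounded_linear_prod_left[OF bb] by (auto simp: bounded_bilinear.prod_left.rep_eq[OF bb])
  define H' where "H' x = G' (F x) o\<^sub>L F' x" for x
  define H'' where "H'' x = (lc (G' (F x)) o\<^sub>L F'' x) + (rc (F' x) o\<^sub>L (G'' (F x) o\<^sub>L F' x))" for x
  have contF: "continuous_on S F" and contF': "continuous_on S F'"
    using F by (metis continuous_at_imp_continuous_on has_derivative_continuous)+
  have "continuous_on T G'"
    using G by (metis continuous_at_imp_continuous_on has_derivative_continuous)
  then have contG': "continuous_on S (\<lambda>x. G' (F x))"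
    by (rule continuous_on_compose2[OF _ contF]) (use assms(3) in blast)
  have contG'': "continuous_on S (\<lambda>x. G'' (F x))"
    by (rule continuous_on_compose2[OF G(3) contF]) (use assms(3) in blast)
  have cont: "continuous_on S H''"
    unfolding H''_def
    by (intro continuous_on_add bounded_bilinear.continuous_on[OF bounded_bilinear_blinfun_compose]
        bounded_linear.continuous_on[OF lc(1)] bounded_linear.continuous_on[OF rc(1)]
        contF' contG' contG'' F(3))
  have d1: "(G \<circ> F has_derivative H' x) (at x)" if "x \<in> S" for x
    using diff_chain_at[OF F(1)[OF that] G(1)[OF FS[OF that]]]
    by (simp add: H'_def blinfun_compose.rep_eq)
  have d2: "(H' has_derivative H'' x) (at x)" if "x \<in> S" for x
  proof -
    have "((\<lambda>x. G' (F x)) has_derivative (\<lambda>h. G'' (F x) (F' x h))) (at x)"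
      using diff_chain_at[OF F(1)[OF that] G(2)[OF FS[OF that]]] by (simp add: o_def)
    from bounded_bilinear.FDERIV[OF bb this F(2)[OF that]]
    show ?thesis
      unfolding H'_def[abs_def]
      by (rule has_derivative_eq_rhs) (simp add: H''_def lc rc fun_eq_iff plus_blinfun.rep_eq)
  qed
  show ?thesis
    unfolding C2_on_def using d1 d2 cont by metis
qed

section \<open>Limits of difference quotients along convergent directions\<close>

text \<open>The remainder of the first-order expansion is negligible against
  \<open>norm (z n - x)\<close>, and the linear part sees only the normalized direction.\<close>

lemma difference_quotient_tendsto:
  fixes G :: "'a::real_normed_vector \<Rightarrow> 'b::real_normed_vector"
  assumes G: "(G has_derivative G') (at x)"
    and z: "z \<longlonglongrightarrow> x" "\<And>n. z n \<noteq> x"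
    and dir: "(\<lambda>n. (z n - x) /\<^sub>R norm (z n - x)) \<longlonglongrightarrow> w"
  shows "(\<lambda>n. (G (z n) - G x) /\<^sub>R norm (z n - x)) \<longlonglongrightarrow> G' w"
proof -
  interpret G': bounded_linear G' using G by (rule has_derivative_bounded_linear)
  have "((\<lambda>y. (G y - G x - G' (y - x)) /\<^sub>R norm (y - x)) \<longlongrightarrow> 0) (at x)"
    using G unfolding has_derivative_at_within by auto
  moreover have "filterlim z (at x) sequentially"
    using z by (simp add: filterlim_at)
  ultimately have "(\<lambda>n. (G (z n) - G x - G' (z n - x)) /\<^sub>R norm (z n - x)) \<longlonglongrightarrow> 0"
    by (rule filterlim_compose)
  moreover have "(\<lambda>n. G' ((z n - x) /\<^sub>R norm (z n - x))) \<longlonglongrightarrow> G' w"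
    using dir by (rule G'.tendsto)
  ultimately have "(\<lambda>n. (G (z n) - G x - G' (z n - x)) /\<^sub>R norm (z n - x)
      + G' ((z n - x) /\<^sub>R norm (z n - x))) \<longlonglongrightarrow> 0 + G' w"
    by (rule tendsto_add)
  then show ?thesis
    by (simp add: G'.scaleR G'.diff scaleR_diff_right)
qed

text \<open>The mean value theorem takes the place of a Taylor expansion: between \<open>x\<close>
  and \<open>z n\<close> lies a point where \<open>H'\<close> is nonpositive in the direction
  \<open>z n - x\<close>. As \<open>H' x = 0\<close>, the difference quotients of \<open>H'\<close>
  at these points tend to \<open>H'' x w\<close>; evaluating them on the directions gives
  \<open>H'' x w w \<le> 0\<close>.\<close>

lemma second_derivative_nonpos_of_sequence:
  fixes H :: "'a::real_normed_vector \<Rightarrow> real"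
  assumes C2: "C2_on T H" and T: "open T" "x \<in> T"
    and stat: "frechet_derivative H (at x) = (\<lambda>_. 0)"
    and z: "z \<longlonglongrightarrow> x" "\<And>n. z n \<noteq> x"
    and dir: "(\<lambda>n. (z n - x) /\<^sub>R norm (z n - x)) \<longlonglongrightarrow> w"
    and le: "\<And>n. H (z n) \<le> H x"
  shows "frechet_derivative (\<lambda>y. frechet_derivative H (at y) w) (at x) w \<le> 0"
proof -
  obtain H' H'' where
    H': "\<And>y. y\<in>T \<Longrightarrow> (H has_derivative blinfun_apply (H' y)) (at y)"
    and H'': "\<And>y. y\<in>T \<Longrightarrow> (H' has_derivative blinfun_apply (H'' y)) (at y)"
    using C2 unfolding C2_on_def by metis
  have H'x: "H' x = 0"
    using frechet_derivative_at[OF H'[OF T(2)]] stat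
    by (metis blinfun_eqI zero_blinfun.rep_eq)
  have "((\<lambda>y. H' y w) has_derivative (\<lambda>h. H'' x h w)) (at x)"
    by (rule bounded_linear.has_derivative[OF blinfun.bounded_linear_left H''[OF T(2)]])
  \<comment> \<open>\<open>frechet_derivative H (at y)\<close> is known to equal \<open>H' y\<close>
    only for \<open>y\<close> in the open set \<open>T\<close>, which suffices for the derivative at
    \<open>x\<close>.\<close>
  then have "((\<lambda>y. frechet_derivative H (at y) w) has_derivative (\<lambda>h. H'' x h w)) (at x)"
    by (rule has_derivative_transform_within_open[OF _ T]) (metis H' frechet_derivative_at)
  then have second: "frechet_derivative (\<lambda>y. frechet_derivative H (at y) w) (at x) w = H'' x w w"
    by (metis frechet_derivative_at)
  obtain e where e: "e > 0" "ball x e \<subseteq> T" using T open_contains_ball by blast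
  \<comment> \<open>The shift by \<open>n0\<close> keeps the whole segment from \<open>x\<close> to
    \<open>z (n + n0)\<close> inside \<open>T\<close>.\<close>
  obtain n0 where n0: "\<And>n. n \<ge> n0 \<Longrightarrow> dist (z n) x < e"
    using z(1) e(1) unfolding lim_sequentially by blast
  have "\<exists>t\<in>{0<..<1}. H' (x + t *\<^sub>R (z (n + n0) - x)) (z (n + n0) - x) \<le> 0" for n
  proof -
    define h where "h = z (n + n0) - x"
    have h: "norm h < e" using n0[of "n + n0"] by (simp add: h_def dist_norm)
    have "\<exists>t\<in>{0<..<1}. H (x + 1 *\<^sub>R h) - H (x + 0 *\<^sub>R h) = (\<lambda>s. H' (x + t *\<^sub>R h) (s *\<^sub>R h)) (1 - 0)"
    proof (rule mvt_simple)
      fix t :: real assume t: "0 \<le> t" "t \<le> 1"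
      have "norm (t *\<^sub>R h) \<le> norm h" using t by (simp add: mult_left_le_one_le)
      then have "x + t *\<^sub>R h \<in> T" using e h by (auto simp: subset_iff dist_norm)
      then have "(H has_derivative H' (x + t *\<^sub>R h)) (at (x + t *\<^sub>R h))" by (rule H')
      moreover have "((\<lambda>t. x + t *\<^sub>R h) has_derivative (\<lambda>s. s *\<^sub>R h)) (at t within {0..1})"
        by (auto intro!: derivative_eq_intros)
      ultimately show "((\<lambda>t. H (x + t *\<^sub>R h)) has_derivative (\<lambda>s. H' (x + t *\<^sub>R h) (s *\<^sub>R h)))
          (at t within {0..1})"
        by (rule has_derivative_compose[rotated])
    qed simp
    moreover have "H (x + h) \<le> H x" using le[of "n + n0"] by (simp add: h_def)
    ultimately show ?thesis unfolding h_def[symmetric] by (auto intro!: bexI)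
  qed
  then obtain t where t: "\<And>n. 0 < t n" "\<And>n. t n < 1"
      "\<And>n. H' (x + t n *\<^sub>R (z (n + n0) - x)) (z (n + n0) - x) \<le> 0"
    unfolding greaterThanLessThan_iff Bex_def by metis
  define u where "u n = (z (n + n0) - x) /\<^sub>R norm (z (n + n0) - x)" for n
  have u: "u \<longlonglongrightarrow> w"
    unfolding u_def using LIMSEQ_ignore_initial_segment[OF dir] .
  define y where "y n = x + t n *\<^sub>R (z (n + n0) - x)" for n
  have nz: "y n \<noteq> x" for n using t(1)[of n] z(2)[of "n + n0"] by (simp add: y_def)
  \<comment> \<open>As \<open>t n\<close> is positive, the intermediate points have the same
    normalized directions as the shifted sequence.\<close>
  have yu: "(y n - x) /\<^sub>R norm (y n - x) = u n" for n
    using t(1)[of n] by (simp add: y_def u_def)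
  have "y \<longlonglongrightarrow> x"
  proof (rule LIM_zero_cancel, rule Lim_null_comparison)
    show "\<forall>\<^sub>F n in sequentially. norm (y n - x) \<le> norm (z (n + n0) - x)"
      using t(1,2) by (auto simp: y_def mult_left_le_one_le less_imp_le)
    show "(\<lambda>n. norm (z (n + n0) - x)) \<longlonglongrightarrow> 0"
      using LIMSEQ_ignore_initial_segment[OF z(1), of n0] LIM_zero tendsto_norm_zero by blast
  qed
  from difference_quotient_tendsto[OF H''[OF T(2)] this nz] yu u
  have "(\<lambda>n. H' (y n) /\<^sub>R norm (y n - x)) \<longlonglongrightarrow> H'' x w" by (simp add: H'x)
  from blinfun.tendsto[OF this u]
  have "(\<lambda>n. (H' (y n) /\<^sub>R norm (y n - x)) (u n)) \<longlonglongrightarrow> H'' x w w" .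
  moreover have "(H' (y n) /\<^sub>R norm (y n - x)) (u n) \<le> 0" for n
    using t(3)[of n]
    by (simp add: scaleR_blinfun.rep_eq u_def blinfun.scaleR_right y_def mult_nonneg_nonpos)
  ultimately have "H'' x w w \<le> 0" by (intro LIMSEQ_le_const2) auto
  then show ?thesis using second by simp
qed

section \<open>The model space\<close>

text \<open>Orthonormality makes the expansion exact on each frame vector, and the frame spans. The
  next two lemmas draw their finite-dimensional content from here.\<close>

lemma manifold_expand:
  fixes M :: "('a::{t2_space,second_countable_topology}, 'e::real_inner) manifold"
  assumes "C2_manifold M"
  shows "(\<Sum>i<mdim M. coord M i x *\<^sub>R frame M i) = x"
proof -
  have on: "frame M i \<bullet> frame M j = (if i = j then 1 else 0)" if "i < mdim M" "j < mdim M" for i j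
    using assms that unfolding C2_manifold_def by blast
  have "x \<in> span (frame M ` {..<mdim M})"
    using assms unfolding C2_manifold_def by simp
  then show ?thesis
  proof (induction rule: span_induct_alt)
    case base
    then show ?case by (simp add: coord_def)
  next
    case (step a b y)
    then obtain j where j: "j < mdim M" "b = frame M j" by auto
    have "(\<Sum>i<mdim M. coord M i (a *\<^sub>R b) *\<^sub>R frame M i)
        = (\<Sum>i<mdim M. if i = j then a *\<^sub>R frame M i else 0)"
      using j on by (intro sum.cong) (auto simp: coord_def)
    also have "\<dots> = a *\<^sub>R b" using j by simp
    finally show ?case
      using step by (simp add: coord_def inner_add_left scaleR_add_left sum.distrib)
  qed
qed

text \<open>A cotangent vector is only algebraically linear; this supplies the continuity required
  to differentiate the multiplier term of the Lagrangian.\<close>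

lemma manifold_linear_imp_bounded_linear:
  fixes M :: "('a::{t2_space,second_countable_topology}, 'e::real_inner) manifold"
  assumes "C2_manifold M" "linear (L :: 'e \<Rightarrow> 'c::real_normed_vector)"
  shows "bounded_linear L"
proof -
  have "L x = (\<Sum>i<mdim M. (x \<bullet> frame M i) *\<^sub>R L (frame M i))" for x
    using manifold_expand[OF assms(1), of x] linear_sum[OF assms(2)] linear_scale[OF assms(2)]
    by (metis (mono_tags, lifting) coord_def sum.cong)
  then have "L = (\<lambda>x. \<Sum>i<mdim M. (x \<bullet> frame M i) *\<^sub>R L (frame M i))" by blast
  moreover have "bounded_linear (\<lambda>x. \<Sum>i<mdim M. (x \<bullet> frame M i) *\<^sub>R L (frame M i))"
    by (intro bounded_linear_sum bounded_linear_scaleR_const bounded_linear_inner_left)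
  ultimately show ?thesis by simp
qed

text \<open>Bolzano-Weierstrass: a subsequence is extracted for the finitely many coordinates, and
  the frame expansion reassembles the limit.\<close>

lemma manifold_bounded_sequence:
  fixes M :: "('a::{t2_space,second_countable_topology}, 'e::real_inner) manifold"
    and u :: "nat \<Rightarrow> 'e"
  assumes M: "C2_manifold M" and u: "\<And>n. norm (u n) \<le> B"
  obtains w r where "strict_mono r" "(u \<circ> r) \<longlonglongrightarrow> w"
proof -
  have on: "frame M i \<bullet> frame M j = (if i = j then 1 else 0)" if "i < mdim M" "j < mdim M" for i j
    using M that unfolding C2_manifold_def by blast
  have "\<forall>\<delta>\<subseteq>{..<mdim M}. \<exists>l::'e. \<exists>r::nat\<Rightarrow>nat.
    strict_mono r \<and> (\<forall>e>0. eventually (\<lambda>n. \<forall>i\<in>\<delta>. dist (coord M i (u (r n))) (coord M i l) < e) sequentially)"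
  proof (rule compact_lemma_general[where proj = "\<lambda>x i. coord M i x"
        and unproj = "\<lambda>a. \<Sum>i<mdim M. a i *\<^sub>R frame M i"])
    fix i assume i: "i \<in> {..<mdim M}"
    have "norm (coord M i (u n)) \<le> B" for n
    proof -
      have "norm (frame M i) = 1" using on[of i i] i by (simp add: norm_eq_1)
      then show ?thesis
        using u[of n] Cauchy_Schwarz_ineq2[of "u n" "frame M i"] by (simp add: coord_def)
    qed
    then show "bounded ((\<lambda>x. coord M i x) ` range u)" by (auto simp: bounded_iff)
    fix a :: "nat \<Rightarrow> real"
    have "coord M i (\<Sum>j<mdim M. a j *\<^sub>R frame M j) = (\<Sum>j<mdim M. if j = i then a j else 0)"
      unfolding coord_def inner_sum_left using i on by (intro sum.cong) auto
    then show "coord M i (\<Sum>j<mdim M. a j *\<^sub>R frame M j) = a i" using i by simp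
  qed (use manifold_expand[OF M] in auto)
  then obtain l r where r: "strict_mono r"
    and l: "\<And>e. e > 0 \<Longrightarrow> eventually (\<lambda>n. \<forall>i\<in>{..<mdim M}. dist (coord M i (u (r n))) (coord M i l) < e) sequentially"
    by blast
  have "(\<lambda>n. coord M i (u (r n))) \<longlonglongrightarrow> coord M i l" if "i < mdim M" for i
    unfolding tendsto_iff
  proof (intro allI impI)
    fix e :: real assume "e > 0"
    from l[OF this] show "\<forall>\<^sub>F n in sequentially. dist (coord M i (u (r n))) (coord M i l) < e"
      by (rule eventually_mono) (use that in auto)
  qed
  then have "(\<lambda>n. \<Sum>i<mdim M. coord M i (u (r n)) *\<^sub>R frame M i) \<longlonglongrightarrow> (\<Sum>i<mdim M. coord M i l *\<^sub>R frame M i)"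
    by (intro tendsto_sum tendsto_scaleR) auto
  then have "(u \<circ> r) \<longlonglongrightarrow> l" by (simp add: manifold_expand[OF M] o_def)
  with r that show ?thesis by blast
qed

section \<open>Charts and tangent vectors\<close>

lemma chart_inv_chart: "topological_chart c \<Longrightarrow> x \<in> fst c \<Longrightarrow> chart_inv c (snd c x) = x"
  unfolding topological_chart_def homeomorphism_def by blast

lemma chart_chart_inv: "topological_chart c \<Longrightarrow> y \<in> snd c ` fst c \<Longrightarrow> snd c (chart_inv c y) = y"
  unfolding topological_chart_def homeomorphism_def by blast

lemma open_chart_image:
  assumes "topological_chart c" "open S"
  shows "open (snd c ` (fst c \<inter> S))"
proof -
  have h: "homeomorphism (fst c) (snd c ` fst c) (snd c) (chart_inv c)"
    and o: "open (fst c)" "open (snd c ` fst c)"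
    using assms(1) unfolding topological_chart_def by auto
  have "openin (top_of_set (snd c ` fst c)) (snd c ` (fst c \<inter> S))"
    by (rule homeomorphism_imp_open_map[OF h]) (use assms o in \<open>simp add: openin_open_Int\<close>)
  then show ?thesis using o(2) openin_open_trans by blast
qed

lemma topological_chart_at: "C2_manifold M \<Longrightarrow> c \<in> charts_at M p \<Longrightarrow> topological_chart c"
  unfolding C2_manifold_def charts_at_def by blast

lemma chart_at_in_charts_at:
  assumes "C2_manifold M"
  shows "chart_at M p \<in> charts_at M p"
proof -
  have "(\<Union>c\<in>charts M. fst c) = UNIV" using assms unfolding C2_manifold_def by blast
  then obtain c where "c \<in> charts_at M p" unfolding charts_at_def by blast
  then show ?thesis unfolding chart_at_def by (rule someI)
qed

text \<open>The transition map of \<open>tangent_space\<close>: it takes the representative in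
  \<open>c\<close> of a tangent vector at \<open>p\<close> to the one in \<open>d\<close>.\<close>

definition chart_change :: "'a \<Rightarrow> ('a, 'e::real_normed_vector) chart \<Rightarrow> ('a, 'e) chart \<Rightarrow> 'e \<Rightarrow> 'e" where
  "chart_change p c d = frechet_derivative (snd d \<circ> chart_inv c) (at (snd c p))"

lemma chart_change_has_derivative:
  assumes "C2_manifold M" "c \<in> charts_at M p" "d \<in> charts_at M p"
  shows "(snd d \<circ> chart_inv c has_derivative chart_change p c d) (at (snd c p))"
proof -
  have "C2_on (snd c ` (fst c \<inter> fst d)) (snd d \<circ> chart_inv c)"
    using assms unfolding C2_manifold_def charts_at_def C2_compatible_def by blast
  then show ?thesis
    unfolding chart_change_def
    by (rule C2_on_imp_has_derivative) (use assms in \<open>auto simp: charts_at_def\<close>)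
qed

text \<open>Chain rule for \<open>h \<circ> chart_inv d\<close> after the transition map. The
  composition agrees with \<open>h \<circ> chart_inv c\<close> on the image of the chart overlap,
  which is open.\<close>

lemma has_derivative_chart_change:
  assumes M: "C2_manifold M" and c: "c \<in> charts_at M p" and d: "d \<in> charts_at M p"
    and h: "(h \<circ> chart_inv d has_derivative h') (at (snd d p))"
  shows "(h \<circ> chart_inv c has_derivative (\<lambda>w. h' (chart_change p c d w))) (at (snd c p))"
proof -
  have tc: "topological_chart c" "topological_chart d"
    using M c d topological_chart_at by blast+
  have p: "p \<in> fst c" "p \<in> fst d" using c d by (auto simp: charts_at_def)
  have "((h \<circ> chart_inv d) \<circ> (snd d \<circ> chart_inv c) has_derivative h' \<circ> chart_change p c d) (at (snd c p))"
    by (rule diff_chain_at[OF chart_change_has_derivative[OF M c d]])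
       (use h p tc in \<open>simp add: chart_inv_chart\<close>)
  then have "((h \<circ> chart_inv d) \<circ> (snd d \<circ> chart_inv c) has_derivative (\<lambda>w. h' (chart_change p c d w))) (at (snd c p))"
    by (simp add: o_def)
  then show ?thesis
  proof (rule has_derivative_transform_within_open)
    show "open (snd c ` (fst c \<inter> fst d))"
      using tc by (intro open_chart_image) (auto simp: topological_chart_def)
  qed (use p tc in \<open>auto simp: chart_inv_chart\<close>)
qed

text \<open>The cocycle identity: both sides are derivatives of the transition from \<open>c\<close>
  to \<open>e\<close>, one of them computed through \<open>d\<close>.\<close>

lemma chart_change_trans:
  assumes "C2_manifold M" "c \<in> charts_at M p" "d \<in> charts_at M p" "e \<in> charts_at M p"
  shows "chart_change p d e (chart_change p c d w) = chart_change p c e w"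
  using has_derivative_chart_change[OF assms(1-3) chart_change_has_derivative[OF assms(1,3,4)]]
    chart_change_has_derivative[OF assms(1,2,4)] has_derivative_unique
  by metis

lemma chart_change_refl:
  assumes "C2_manifold M" "c \<in> charts_at M p"
  shows "chart_change p c c w = w"
proof -
  have tc: "topological_chart c" using assms topological_chart_at by blast
  have "((\<lambda>x. x) has_derivative (\<lambda>x. x)) (at (snd c p))" by simp
  then have "(snd c \<circ> chart_inv c has_derivative (\<lambda>x. x)) (at (snd c p))"
    by (rule has_derivative_transform_within_open[where s = "snd c ` fst c"])
       (use assms tc in \<open>auto simp: topological_chart_def chart_chart_inv[OF tc] charts_at_def\<close>)
  then show ?thesis
    using chart_change_has_derivative[OF assms assms(2)] has_derivative_unique by metis
qed

lemma tangent_spaceI: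
  assumes "\<And>c. c \<notin> charts_at M p \<Longrightarrow> v c = 0"
    and "\<And>c d. c \<in> charts_at M p \<Longrightarrow> d \<in> charts_at M p \<Longrightarrow> v d = chart_change p c d (v c)"
  shows "v \<in> tangent_space M p"
  unfolding tangent_space_def using assms[unfolded chart_change_def] by blast

text \<open>The inverse of evaluating a tangent vector at \<open>c\<close>. The value
  \<open>0\<close> away from \<open>p\<close> matches the normalization in
  \<open>tangent_space\<close>, so that tangent vectors can be compared as functions.\<close>

definition tangent_vector ::
    "('a, 'e::real_normed_vector) manifold \<Rightarrow> 'a \<Rightarrow> ('a, 'e) chart \<Rightarrow> 'e \<Rightarrow> ('a, 'e) tangent" where
  "tangent_vector M p c w = (\<lambda>d. if d \<in> charts_at M p then chart_change p c d w else 0)"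

lemma tangent_vector_in_tangent_space:
  assumes "C2_manifold M" "c \<in> charts_at M p"
  shows "tangent_vector M p c w \<in> tangent_space M p"
  using chart_change_trans[OF assms] by (intro tangent_spaceI) (simp_all add: tangent_vector_def)

lemma tangent_vector_apply:
  assumes "C2_manifold M" "c \<in> charts_at M p"
  shows "tangent_vector M p c w c = w"
  unfolding tangent_vector_def using assms chart_change_refl by metis

lemma tangent_space_apply:
  assumes "v \<in> tangent_space M p" "c \<in> charts_at M p" "d \<in> charts_at M p"
  shows "v d = chart_change p c d (v c)"
  using assms unfolding tangent_space_def chart_change_def by blast

lemma tangent_vector_of_tangent:
  assumes "v \<in> tangent_space M p" "c \<in> charts_at M p"
  shows "tangent_vector M p c (v c) = v"
proof
  fix d
  show "tangent_vector M p c (v c) d = v d"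
  proof (cases "d \<in> charts_at M p")
    case True
    then show ?thesis using tangent_space_apply[OF assms] by (simp add: tangent_vector_def)
  next
    case False
    moreover from this have "v d = 0" using assms(1) unfolding tangent_space_def by blast
    ultimately show ?thesis by (simp add: tangent_vector_def)
  qed
qed

lemma bounded_linear_chart_change:
  assumes "C2_manifold M" "c \<in> charts_at M p" "d \<in> charts_at M p"
  shows "bounded_linear (chart_change p c d)"
  using chart_change_has_derivative[OF assms] by (rule has_derivative_bounded_linear)

text \<open>A cotangent vector is additive and homogeneous only on the tangent space; the pullback
  to the model space is linear everywhere.\<close>

lemma linear_cotangent_tangent_vector:
  assumes M: "C2_manifold M" and c: "c \<in> charts_at M p" and \<mu>: "\<mu> \<in> cotangent_space M p"
  shows "linear (\<lambda>w. \<mu> (tangent_vector M p c w))"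
proof (rule linearI)
  have ts: "\<And>w. tangent_vector M p c w \<in> tangent_space M p"
    using tangent_vector_in_tangent_space[OF M c] .
  note lin = bounded_linear.linear[OF bounded_linear_chart_change[OF M c]]
  fix x y a
  have "tangent_vector M p c (x + y) = (\<lambda>d. tangent_vector M p c x d + tangent_vector M p c y d)"
    using lin by (auto simp: tangent_vector_def linear_add)
  then show "\<mu> (tangent_vector M p c (x + y)) = \<mu> (tangent_vector M p c x) + \<mu> (tangent_vector M p c y)"
    using \<mu> ts unfolding cotangent_space_def by simp
  have "tangent_vector M p c (a *\<^sub>R x) = (\<lambda>d. a *\<^sub>R tangent_vector M p c x d)"
    using lin by (auto simp: tangent_vector_def linear_scale)
  then show "\<mu> (tangent_vector M p c (a *\<^sub>R x)) = a *\<^sub>R \<mu> (tangent_vector M p c x)"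
    using \<mu> ts unfolding cotangent_space_def by simp
qed

lemma open_chart_preimage:
  assumes "C2_manifold M" "c \<in> charts_at M p" "continuous_on UNIV g" "open V"
  shows "open (snd c ` (fst c \<inter> g -` V))"
  using assms by (intro open_chart_image topological_chart_at[of M c p] open_vimage)

lemma C2_map_has_derivative:
  assumes "C2_map M N g" "c \<in> charts_at M p" "d \<in> charts_at N (g p)"
  shows "(snd d \<circ> g \<circ> chart_inv c has_derivative
      frechet_derivative (snd d \<circ> g \<circ> chart_inv c) (at (snd c p))) (at (snd c p))"
  by (rule C2_on_imp_has_derivative[where S = "snd c ` (fst c \<inter> g -` fst d)"])
     (use assms in \<open>auto simp: C2_map_def charts_at_def\<close>)

text \<open>The chain rule for a transition map of \<open>N\<close> after \<open>g\<close> relates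
  the representatives in two charts.\<close>

lemma deriv_map_in_tangent_space:
  assumes M: "C2_manifold M" and N: "C2_manifold N" and g: "C2_map M N g"
  shows "deriv_map M N g p v \<in> tangent_space N (g p)"
proof -
  define c where "c = chart_at M p"
  have c: "c \<in> charts_at M p" unfolding c_def using M by (rule chart_at_in_charts_at)
  have pc: "chart_inv c (snd c p) = p" "p \<in> fst c"
    using c chart_inv_chart[OF topological_chart_at[OF M c]] by (auto simp: charts_at_def)
  let ?D = "\<lambda>d. frechet_derivative (snd d \<circ> g \<circ> chart_inv c) (at (snd c p))"
  have coherent: "?D e w = chart_change (g p) d e (?D d w)"
    if d: "d \<in> charts_at N (g p)" and e: "e \<in> charts_at N (g p)" for d e w
  proof -
    have td: "topological_chart d" using topological_chart_at[OF N d] .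
    have "((snd e \<circ> chart_inv d) \<circ> (snd d \<circ> g \<circ> chart_inv c) has_derivative
        chart_change (g p) d e \<circ> ?D d) (at (snd c p))"
      by (rule diff_chain_at[OF C2_map_has_derivative[OF g c d]])
         (use chart_change_has_derivative[OF N d e] pc in simp)
    then have "(snd e \<circ> g \<circ> chart_inv c has_derivative chart_change (g p) d e \<circ> ?D d) (at (snd c p))"
    proof (rule has_derivative_transform_within_open)
      show "open (snd c ` (fst c \<inter> g -` fst d))"
        by (rule open_chart_preimage[OF M c]) (use g td in \<open>auto simp: C2_map_def topological_chart_def\<close>)
    qed (use pc d in \<open>auto simp: charts_at_def chart_inv_chart[OF td] chart_inv_chart[OF topological_chart_at[OF M c]]\<close>)
    then show ?thesis
      using C2_map_has_derivative[OF g c e] has_derivative_unique by (metis comp_apply)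
  qed
  have "deriv_map M N g p v = (\<lambda>d. if d \<in> charts_at N (g p) then ?D d (v c) else 0)"
    unfolding deriv_map_def Let_def c_def ..
  then show ?thesis by (intro tangent_spaceI) (simp_all add: coherent[symmetric])
qed

section \<open>The inner tangent cone\<close>

lemma closed_corner_cone: "closed (corner_cone N k l A)"
proof -
  have "corner_cone N k l A = (\<Inter>i\<in>{k..<mdim N}. {x. coord N i x = 0}) \<inter>
      (\<Inter>j\<in>{..<l}. {x. (\<Sum>i<k. A j i * coord N i x) \<le> 0})"
    unfolding corner_cone_def by auto
  also have "closed \<dots>"
    unfolding coord_def
    by (intro closed_Int closed_INT ballI closed_Collect_eq closed_Collect_le continuous_intros)
  finally show ?thesis .
qed

lemma corner_cone_scaleR:
  assumes "x \<in> corner_cone N k l A" "0 \<le> a"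
  shows "a *\<^sub>R x \<in> corner_cone N k l A"
proof -
  have "(\<Sum>i<k. A j i * coord N i (a *\<^sub>R x)) = a * (\<Sum>i<k. A j i * coord N i x)" for j
    unfolding coord_def sum_distrib_left by (intro sum.cong) auto
  then show ?thesis
    using assms by (auto simp: corner_cone_def coord_def mult_nonneg_nonpos)
qed

lemma adapted_chart_at: "adapted_chart N k K q c l A \<Longrightarrow> c \<in> charts_at N q \<and> snd c q = 0"
  unfolding adapted_chart_def by blast

text \<open>Injectivity of the chart turns the equality of images in \<open>adapted_chart\<close>
  into a pointwise test.\<close>

lemma adapted_chart_iff:
  assumes "C2_manifold N" "adapted_chart N k K q c l A" "y \<in> fst c"
  shows "snd c y \<in> corner_cone N k l A \<longleftrightarrow> y \<in> K"
proof -
  have tc: "topological_chart c" and K: "snd c ` (K \<inter> fst c) = {x \<in> snd c ` fst c. x \<in> corner_cone N k l A}"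
    using assms topological_chart_at unfolding adapted_chart_def by blast+
  show ?thesis
  proof
    assume "snd c y \<in> corner_cone N k l A"
    then obtain y' where "y' \<in> K" "y' \<in> fst c" "snd c y = snd c y'"
      using K assms(3) by blast
    then show "y \<in> K" using chart_inv_chart[OF tc] assms(3) by metis
  qed (use K assms(3) in blast)
qed

text \<open>
  For \<open>v\<close> in the cone of one adapted chart, the curve \<open>t \<mapsto> t v\<close> stays in \<open>K\<close> for small
  \<open>t \<ge> 0\<close>; in another adapted chart it lies in the other cone, hence so does its velocity.
\<close>
lemma chart_change_corner_cone:
  assumes N: "C2_manifold N" and c: "adapted_chart N k K q c l A" and d: "adapted_chart N k K q d l' B"
    and v: "v \<in> corner_cone N k l A"
  shows "chart_change q c d v \<in> corner_cone N k l' B"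
proof -
  have c': "c \<in> charts_at N q" "snd c q = 0" and d': "d \<in> charts_at N q" "snd d q = 0"
    using adapted_chart_at[OF c] adapted_chart_at[OF d] by auto
  have tc: "topological_chart c" "topological_chart d"
    using topological_chart_at[OF N] c' d' by auto
  have q: "q \<in> fst c" "q \<in> fst d" using c' d' by (auto simp: charts_at_def)
  let ?\<tau> = "snd d \<circ> chart_inv c"
  have "open (snd c ` (fst c \<inter> fst d))"
    using tc by (intro open_chart_image) (auto simp: topological_chart_def)
  moreover have "0 \<in> snd c ` (fst c \<inter> fst d)" using q c' by force
  moreover have "(\<lambda>n. (1 / real (Suc n)) *\<^sub>R v) \<longlonglongrightarrow> 0"
    using tendsto_scaleR[OF LIMSEQ_Suc[OF lim_1_over_n] tendsto_const[of v]] by simp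
  ultimately have ev: "\<forall>\<^sub>F n in sequentially. (1 / real (Suc n)) *\<^sub>R v \<in> snd c ` (fst c \<inter> fst d)"
    using topological_tendstoD by blast
  \<comment> \<open>The curve is sampled at the times \<open>1 / real (Suc n)\<close>. Multiplying
    back by \<open>real (Suc n)\<close> stays in the cone and produces a difference quotient at
    \<open>0\<close>, as both charts send \<open>q\<close> to \<open>0\<close>.\<close>
  have "\<forall>\<^sub>F n in sequentially. real (Suc n) *\<^sub>R ?\<tau> ((1 / real (Suc n)) *\<^sub>R v) \<in> corner_cone N k l' B"
    using ev
  proof (rule eventually_mono)
    fix n assume "(1 / real (Suc n)) *\<^sub>R v \<in> snd c ` (fst c \<inter> fst d)"
    then obtain y where y: "y \<in> fst c" "y \<in> fst d" "(1 / real (Suc n)) *\<^sub>R v = snd c y" by auto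
    moreover have "(1 / real (Suc n)) *\<^sub>R v \<in> corner_cone N k l A"
      by (rule corner_cone_scaleR[OF v]) simp
    ultimately have "snd d y \<in> corner_cone N k l' B"
      using adapted_chart_iff[OF N c] adapted_chart_iff[OF N d] by metis
    then show "real (Suc n) *\<^sub>R ?\<tau> ((1 / real (Suc n)) *\<^sub>R v) \<in> corner_cone N k l' B"
      unfolding y(3) using y chart_inv_chart[OF tc(1)] by (auto intro: corner_cone_scaleR)
  qed
  moreover have "(\<lambda>n. real (Suc n) *\<^sub>R ?\<tau> ((1 / real (Suc n)) *\<^sub>R v)) \<longlonglongrightarrow> chart_change q c d v"
  proof -
    have "(?\<tau> has_derivative chart_change q c d) (at 0)"
      using chart_change_has_derivative[OF N c'(1) d'(1)] c' by simp
    moreover have "((\<lambda>t. t *\<^sub>R v) has_derivative (\<lambda>t. t *\<^sub>R v)) (at (0::real))"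
      by (auto intro!: derivative_eq_intros)
    ultimately have "((\<lambda>t. ?\<tau> (t *\<^sub>R v)) has_derivative (\<lambda>t. chart_change q c d (t *\<^sub>R v))) (at (0::real))"
      by (intro has_derivative_compose[of _ _ 0 UNIV ?\<tau>]) auto
    \<comment> \<open>The times approach \<open>0\<close> from the right, so their normalized
      direction is constantly \<open>1\<close>.\<close>
    then have "(\<lambda>n. (?\<tau> ((1 / real (Suc n)) *\<^sub>R v) - ?\<tau> (0 *\<^sub>R v)) /\<^sub>R norm (1 / real (Suc n) - 0))
        \<longlonglongrightarrow> chart_change q c d (1 *\<^sub>R v)"
      by (rule difference_quotient_tendsto) (use LIMSEQ_Suc[OF lim_1_over_n] in \<open>auto simp: field_simps\<close>)
    moreover have "?\<tau> 0 = 0"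
      using chart_inv_chart[OF tc(1) q(1)] c' d' by simp
    ultimately show ?thesis by simp
  qed
  ultimately show ?thesis
    by (rule Lim_in_closed_set[OF closed_corner_cone _ sequentially_bot])
qed

text \<open>The definition asks for some adapted chart; invariance of the cone under chart changes
  moves the test to any prescribed one.\<close>

lemma inner_tangent_cone_iff:
  assumes "C2_manifold N" "adapted_chart N k K q c l A"
  shows "v \<in> inner_tangent_cone N k K q \<longleftrightarrow> v \<in> tangent_space N q \<and> v c \<in> corner_cone N k l A"
proof
  assume "v \<in> inner_tangent_cone N k K q"
  then obtain d l' B where v: "v \<in> tangent_space N q"
    and d: "adapted_chart N k K q d l' B" "v d \<in> corner_cone N k l' B"
    unfolding inner_tangent_cone_def by blast
  have "v c = chart_change q d c (v d)"
    using tangent_space_apply[OF v] adapted_chart_at[OF d(1)] adapted_chart_at[OF assms(2)] by blast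
  then show "v \<in> tangent_space N q \<and> v c \<in> corner_cone N k l A"
    using v chart_change_corner_cone[OF assms(1) d(1) assms(2) d(2)] by simp
qed (use assms in \<open>unfold inner_tangent_cone_def, blast\<close>)

section \<open>Adapted linearizing maps\<close>

text \<open>The adapted chart itself, read as a map into the tangent space, is a witness. Hence the
  choice in \<open>some_adapted_linearizing_map\<close> satisfies its specification.\<close>

lemma adapted_linearizing_map_exists:
  assumes N: "C2_manifold N" and ad: "adapted_chart N k K q c l A"
  shows "adapted_linearizing_map N k K q (fst c) (\<lambda>y. tangent_vector N q c (snd c y))"
proof -
  let ?S = "\<lambda>y. tangent_vector N q c (snd c y)"
  have c: "c \<in> charts_at N q" "snd c q = 0" using adapted_chart_at[OF ad] by auto
  have tc: "topological_chart c" using topological_chart_at[OF N c(1)] .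
  have q: "q \<in> fst c" using c by (simp add: charts_at_def)
  have Sc: "?S y c = snd c y" for y using tangent_vector_apply[OF N c(1)] .
  have Sd: "?S y d = chart_change q c d (snd c y)" if "d \<in> charts_at N q" for d y
    using that by (simp add: tangent_vector_def)
  have "C2_on (snd d ` (fst d \<inter> fst c)) (\<lambda>x. ?S (chart_inv d x) e)"
    if e: "e \<in> charts_at N q" and d: "d \<in> charts N" for d e
  proof -
    have "C2_on (snd d ` (fst d \<inter> fst c)) (snd c \<circ> chart_inv d)"
      using N c d unfolding C2_manifold_def charts_at_def C2_compatible_def by blast
    from C2_on_compose[OF this C2_on_bounded_linear[OF bounded_linear_chart_change[OF N c(1) e], of UNIV]]
    show ?thesis by (simp add: o_def Sd[OF e])
  qed
  moreover have "?S q = (\<lambda>d. 0)"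
    using bounded_linear_chart_change[OF N c(1)] linear_0 bounded_linear.linear
    by (auto simp: tangent_vector_def c fun_eq_iff)
  moreover have "frechet_derivative (\<lambda>x. ?S (chart_inv d x) e) (at (snd d q)) (v d) = v e"
    if e: "e \<in> charts_at N q" and d: "d \<in> charts_at N q" and v: "v \<in> tangent_space N q" for d e v
  proof -
    \<comment> \<open>In coordinates the derivative is the transition from \<open>d\<close> to
      \<open>c\<close> to \<open>e\<close>; by the cocycle identity it represents the identity of
      the tangent space.\<close>
    have "((\<lambda>x. chart_change q c e ((snd c \<circ> chart_inv d) x)) has_derivative
        (\<lambda>w. chart_change q c e (chart_change q d c w))) (at (snd d q))"
      by (rule bounded_linear.has_derivative[OF bounded_linear_chart_change[OF N c(1) e]
          chart_change_has_derivative[OF N d c(1)]])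
    then have "frechet_derivative (\<lambda>x. ?S (chart_inv d x) e) (at (snd d q)) =
        (\<lambda>w. chart_change q c e (chart_change q d c w))"
      unfolding Sd[OF e] o_def by (rule frechet_derivative_at[symmetric])
    then show ?thesis
      using chart_change_trans[OF N d c(1) e] tangent_space_apply[OF v d e] by simp
  qed
  ultimately have "linearizing_map N q (fst c) ?S"
    unfolding linearizing_map_def
    using tc q tangent_vector_in_tangent_space[OF N c(1)] by (auto simp: topological_chart_def)
  moreover have "inj_on ?S (fst c)"
  proof (rule inj_onI)
    fix x y assume "x \<in> fst c" "y \<in> fst c" "?S x = ?S y"
    moreover from this(3) have "?S x c = ?S y c" by (rule fun_cong)
    ultimately show "x = y" unfolding Sc using chart_inv_chart[OF tc] by metis
  qed
  moreover have "?S ` (fst c \<inter> K) = ?S ` fst c \<inter> inner_tangent_cone N k K q"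
  proof -
    have "?S y \<in> inner_tangent_cone N k K q \<longleftrightarrow> y \<in> K" if "y \<in> fst c" for y
      unfolding inner_tangent_cone_iff[OF N ad] Sc adapted_chart_iff[OF N ad that]
      using tangent_vector_in_tangent_space[OF N c(1)] by simp
    then show ?thesis by blast
  qed
  ultimately show ?thesis
    unfolding adapted_linearizing_map_def by blast
qed

theorem theorem8p5:
  fixes M :: "('a::{t2_space,second_countable_topology}, 'd::real_inner) manifold"
    and N :: "('b::{t2_space,second_countable_topology}, 'e::real_inner) manifold"
    and m n k :: nat
    and K :: "'b set"
    and f :: "'a \<Rightarrow> real"
    and g :: "'a \<Rightarrow> 'b"
    and F :: "'a set"
    and p :: 'a
    and \<mu> :: "('b, 'e) tangent \<Rightarrow> real"
  assumes "C2_manifold M" and "mdim M = m"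
    and "C2_manifold N" and "mdim N = n"
    and "submanifold_with_corners N k K"
    and "C2_function M f"
    and "C2_map M N g"
    and "F = {x. g x \<in> K}"
    and "p \<in> F"
    and "\<mu> \<in> cotangent_space N (g p)"
    and "KKT_point M N k K f g p \<mu>"
    and "\<forall>v \<in> critical_cone M N k K f g p - {\<lambda>c. 0}.
           lagrangian_second_deriv M N k K f g p \<mu> v > 0"
  shows "strict_local_minimizer f F p"
proof (rule ccontr)
  assume not_min: "\<not> strict_local_minimizer f F p"
  note M = assms(1) and N = assms(3) and f = assms(6) and g = assms(7)

  \<comment> \<open>The cone and the linearizing map at the image point\<close>
  define q where "q = g p"
  have qK: "q \<in> K" using assms(8,9) by (simp add: q_def)
  then obtain c l A where ad: "adapted_chart N k K q c l A"
    using assms(5) unfolding submanifold_with_corners_def by blast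
  have c: "c \<in> charts_at N q" "q \<in> fst c" "c \<in> charts N"
    using adapted_chart_at[OF ad] by (auto simp: charts_at_def)
  have tc: "topological_chart c" using topological_chart_at[OF N c(1)] .
  define S where "S = some_adapted_linearizing_map N k K q"
  \<comment> \<open>\<open>S\<close> is the very map chosen in
    \<open>lagrangian_second_deriv\<close>; existence of a witness gives it the properties of an
    adapted linearizing map.\<close>
  have "\<exists>S U. adapted_linearizing_map N k K q U S"
    using adapted_linearizing_map_exists[OF N ad] by blast
  then have "\<exists>U. adapted_linearizing_map N k K q U S"
    unfolding S_def some_adapted_linearizing_map_def by (rule someI_ex)
  then obtain U where "adapted_linearizing_map N k K q U S" by blast
  then have lin: "linearizing_map N q U S" and SUK: "S ` (U \<inter> K) \<subseteq> inner_tangent_cone N k K q"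
    unfolding adapted_linearizing_map_def by auto
  have U: "open U" "q \<in> U" and Sts: "\<And>y. y \<in> U \<Longrightarrow> S y \<in> tangent_space N q"
    and Sq: "S q = (\<lambda>c. 0)"
    using lin unfolding linearizing_map_def by auto

  \<comment> \<open>The Lagrangian in coordinates\<close>
  define \<phi> where "\<phi> = chart_at M p"
  \<comment> \<open>\<open>deriv_function\<close>, \<open>deriv_map\<close> and
    \<open>second_deriv_function\<close> all select this chart, so their values can be read off in
    it.\<close>
  have \<phi>: "\<phi> \<in> charts_at M p" unfolding \<phi>_def using M by (rule chart_at_in_charts_at)
  then have p\<phi>: "p \<in> fst \<phi>" "\<phi> \<in> charts M" by (auto simp: charts_at_def)
  have t\<phi>: "topological_chart \<phi>" using topological_chart_at[OF M \<phi>] .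
  have inv\<phi>: "\<And>x. x \<in> fst \<phi> \<Longrightarrow> chart_inv \<phi> (snd \<phi> x) = x" using chart_inv_chart[OF t\<phi>] .
  have contg: "continuous_on UNIV g" using g by (simp add: C2_map_def)
  define x0 where "x0 = snd \<phi> p"
  \<comment> \<open>On \<open>V\<close> the chart at \<open>p\<close>, the chart at
    \<open>g p\<close> composed with \<open>g\<close>, and \<open>S\<close> after \<open>g\<close>
    are all available.\<close>
  define V where "V = fst \<phi> \<inter> g -` (fst c \<inter> U)"
  define T where "T = snd \<phi> ` V"
  have oc: "open (fst c \<inter> U)" using tc U by (auto simp: topological_chart_def)
  have T: "open T" "x0 \<in> T"
    unfolding T_def V_def x0_def
    using open_chart_preimage[OF M \<phi> contg oc] p\<phi> c U by (auto simp: q_def)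
  have V: "open V" "p \<in> V"
    unfolding V_def using t\<phi> open_vimage[OF oc contg] p\<phi> c U
    by (auto simp: topological_chart_def q_def)

  \<comment> \<open>The representative of \<open>\<mu>\<close> in \<open>c\<close>; with it the
    Lagrangian becomes a sum of compositions between model spaces.\<close>
  define \<nu> where "\<nu> w = \<mu> (tangent_vector N q c w)" for w
  have \<nu>: "bounded_linear \<nu>"
    unfolding \<nu>_def
    using linear_cotangent_tangent_vector[OF N c(1)] assms(10)
    by (intro manifold_linear_imp_bounded_linear[OF N]) (simp add: q_def)
  have \<mu>\<nu>: "\<mu> v = \<nu> (v c)" if "v \<in> tangent_space N q" for v
    unfolding \<nu>_def using tangent_vector_of_tangent[OF that c(1)] by simp

  define s where "s y = S (chart_inv c y) c" for y
  define G where "G = snd c \<circ> g \<circ> chart_inv \<phi>"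
  define f\<phi> where "f\<phi> = f \<circ> chart_inv \<phi>"
  define H where "H = lagrangian f g \<mu> S \<circ> chart_inv \<phi>"
  have Hx: "f\<phi> x + \<nu> (s (G x)) = H x" if "x \<in> T" for x
    using that \<mu>\<nu>[OF Sts]
    by (auto simp: T_def V_def H_def lagrangian_def f\<phi>_def s_def G_def inv\<phi> chart_inv_chart[OF tc])
  have C2s: "C2_on (snd c ` (fst c \<inter> U)) s"
    using lin c unfolding linearizing_map_def s_def by blast
  have C2G: "C2_on T G"
  proof -
    have "C2_on (snd \<phi> ` (fst \<phi> \<inter> g -` fst c)) G"
      using g c p\<phi> unfolding C2_map_def G_def by blast
    then show ?thesis by (rule C2_on_subset) (auto simp: T_def V_def)
  qed
  have C2f: "C2_on T f\<phi>"
  proof (rule C2_on_subset)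
    show "C2_on (snd \<phi> ` fst \<phi>) f\<phi>"
      using f p\<phi> unfolding C2_function_def f\<phi>_def by blast
  qed (auto simp: T_def V_def)
  have GT: "G ` T \<subseteq> snd c ` (fst c \<inter> U)"
    by (auto simp: T_def V_def G_def inv\<phi>)
  have C2sG: "C2_on T (s \<circ> G)" using C2_on_compose[OF C2G C2s GT] .
  have C2H: "C2_on T H"
  proof (rule C2_on_cong)
    show "C2_on T (\<lambda>x. f\<phi> x + (\<nu> \<circ> (s \<circ> G)) x)"
      by (rule C2_on_add[OF C2f C2_on_compose[OF C2sG C2_on_bounded_linear[OF \<nu>, of UNIV]]]) simp
  qed (use T Hx in auto)

  \<comment> \<open>First-order conditions in coordinates\<close>
  define DG where "DG = frechet_derivative G (at x0)"
  define Df where "Df = frechet_derivative f\<phi> (at x0)"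
  have Df: "(f\<phi> has_derivative Df) (at x0)"
    unfolding Df_def using C2_on_imp_has_derivative[OF C2f T(2)] .
  have Gx0: "G x0 = snd c q" by (simp add: G_def x0_def inv\<phi> p\<phi> q_def)
  \<comment> \<open>The derivative condition on \<open>S\<close>, with both charts equal to
    \<open>c\<close> and tested on the vector represented by \<open>w\<close>, gives the identity.
    Hence \<open>s \<circ> G\<close> has the same derivative at \<open>x0\<close> as
    \<open>G\<close>.\<close>
  have Ds: "(s has_derivative (\<lambda>w. w)) (at (snd c q))"
  proof -
    have "frechet_derivative s (at (snd c q)) w = w" for w
    proof -
      let ?v = "tangent_vector N q c w"
      have "?v \<in> tangent_space N q" "?v c = w"
        using tangent_vector_in_tangent_space[OF N c(1)] tangent_vector_apply[OF N c(1)] by auto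
      then show ?thesis using lin c(1) unfolding linearizing_map_def s_def by metis
    qed
    moreover have "snd c q \<in> snd c ` (fst c \<inter> U)" using c U by blast
    ultimately show ?thesis using C2_on_imp_has_derivative[OF C2s] by (metis (no_types) ext)
  qed
  have DsG: "(s \<circ> G has_derivative DG) (at x0)"
    using diff_chain_at[OF C2_on_imp_has_derivative[OF C2G T(2)], of s "\<lambda>w. w"] Ds Gx0
    by (simp add: DG_def o_def)
  have deriv_f: "deriv_function M f p v = Df (v \<phi>)" for v
    by (simp add: deriv_function_def Df_def f\<phi>_def \<phi>_def x0_def Let_def)
  have deriv_g: "deriv_map M N g p v c = DG (v \<phi>)" for v
    using c by (simp add: deriv_map_def DG_def G_def \<phi>_def x0_def Let_def q_def)
  have deriv_g_ts: "deriv_map M N g p v \<in> tangent_space N q" for v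
    unfolding q_def using deriv_map_in_tangent_space[OF M N g] .
  \<comment> \<open>Every \<open>w\<close> represents a tangent vector, so the KKT equation extends
    to the whole model space.\<close>
  have kkt: "Df w + \<nu> (DG w) = 0" for w
  proof -
    let ?v = "tangent_vector M p \<phi> w"
    have v: "?v \<in> tangent_space M p" "?v \<phi> = w"
      using tangent_vector_in_tangent_space[OF M \<phi>] tangent_vector_apply[OF M \<phi>] by auto
    then have "deriv_function M f p ?v + \<mu> (deriv_map M N g p ?v) = 0"
      using assms(11) unfolding KKT_point_def by blast
    then show ?thesis using \<mu>\<nu>[OF deriv_g_ts] v by (simp add: deriv_f deriv_g)
  qed
  have polar: "\<mu> v \<le> 0" if "v \<in> inner_tangent_cone N k K q" for v
    using that assms(11) unfolding KKT_point_def polar_cone_def q_def by blast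
  have stat: "frechet_derivative H (at x0) = (\<lambda>_. 0)"
  proof -
    have "((\<lambda>x. f\<phi> x + \<nu> ((s \<circ> G) x)) has_derivative (\<lambda>w. Df w + \<nu> (DG w))) (at x0)"
      by (intro has_derivative_add Df bounded_linear.has_derivative[OF \<nu>] DsG)
    then have "(H has_derivative (\<lambda>w. 0)) (at x0)"
      unfolding kkt by (rule has_derivative_transform_within_open[OF _ T]) (simp add: Hx)
    then show ?thesis by (metis frechet_derivative_at)
  qed

  \<comment> \<open>Feasible points contradicting strict minimality\<close>
  have "\<exists>x. x \<in> V \<and> snd \<phi> x \<in> ball x0 (1 / real (Suc i)) \<and> x \<in> F \<and> x \<noteq> p \<and> f x \<le> f p" for i
  proof -
    \<comment> \<open>Balls around \<open>x0\<close> pulled back through the chart are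
      neighbourhoods of \<open>p\<close>; minimality fails in each of them, also after intersection
      with \<open>V\<close>.\<close>
    have "open (fst \<phi> \<inter> snd \<phi> -` ball x0 (1 / real (Suc i)))"
      by (rule continuous_open_preimage)
         (use t\<phi> in \<open>auto simp: topological_chart_def homeomorphism_def\<close>)
    then have "open (V \<inter> (fst \<phi> \<inter> snd \<phi> -` ball x0 (1 / real (Suc i))))"
      using V by blast
    moreover have "p \<in> V \<inter> (fst \<phi> \<inter> snd \<phi> -` ball x0 (1 / real (Suc i)))"
      using V p\<phi> by (simp add: x0_def)
    ultimately show ?thesis
      using not_min assms(9) unfolding strict_local_minimizer_def by (metis IntD1 IntD2 linorder_not_less vimageD)
  qed
  then obtain X where X: "\<And>i. X i \<in> V" "\<And>i. snd \<phi> (X i) \<in> ball x0 (1 / real (Suc i))"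
      "\<And>i. X i \<in> F" "\<And>i. X i \<noteq> p" "\<And>i. f (X i) \<le> f p"
    by metis
  define z where "z i = snd \<phi> (X i)" for i
  have z: "z \<longlonglongrightarrow> x0"
  proof (rule metric_tendsto_imp_tendsto[where f = "\<lambda>n. 1 / real (Suc n)" and a = 0])
    show "\<forall>\<^sub>F i in sequentially. dist (z i) x0 \<le> dist (1 / real (Suc i)) 0"
      using X(2) by (auto simp: z_def dist_commute less_imp_le)
  qed (rule LIMSEQ_Suc[OF lim_1_over_n])
  have Xz: "chart_inv \<phi> (z i) = X i" for i
    using X(1)[of i] by (simp add: z_def inv\<phi> V_def)
  have zx0: "z i \<noteq> x0" for i
    using Xz[of i] X(4)[of i] inv\<phi>[OF p\<phi>(1)] by (auto simp: x0_def)
  have zT: "z i \<in> T" for i using X(1) by (simp add: z_def T_def)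
  have cone: "S (g (X i)) \<in> inner_tangent_cone N k K q" for i
    using X(1)[of i] X(3)[of i] SUK assms(8) by (auto simp: V_def)
  have sGz: "(s \<circ> G) (z i) \<in> corner_cone N k l A" for i
    using cone[of i] inner_tangent_cone_iff[OF N ad] X(1)[of i]
    by (simp add: s_def G_def Xz V_def chart_inv_chart[OF tc])
  have sGx0: "(s \<circ> G) x0 = 0"
    by (simp add: Gx0 s_def chart_inv_chart[OF tc c(2)] Sq)

  \<comment> \<open>The limit direction\<close>
  define u where "u i = (z i - x0) /\<^sub>R norm (z i - x0)" for i
  have nu: "norm (u i) = 1" for i using zx0[of i] by (simp add: u_def)
  obtain w r where r: "strict_mono r" "(u \<circ> r) \<longlonglongrightarrow> w"
  proof (rule manifold_bounded_sequence[OF M])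
    show "norm (u i) \<le> 1" for i by (simp add: nu)
  qed
  define y where "y = z \<circ> r"
  have y: "y \<longlonglongrightarrow> x0" "\<And>i. y i \<noteq> x0"
    using LIMSEQ_subseq_LIMSEQ[OF z r(1)] zx0 by (auto simp: y_def)
  have dir: "(\<lambda>i. (y i - x0) /\<^sub>R norm (y i - x0)) \<longlonglongrightarrow> w"
    using r(2) by (simp add: y_def u_def o_def)
  \<comment> \<open>Unit length survives in the limit, which makes the resulting tangent vector
    nonzero.\<close>
  have "norm w = 1"
    using LIMSEQ_unique[OF tendsto_norm[OF r(2)]] nu by simp

  \<comment> \<open>Criticality of the limit direction\<close>
  define v where "v = tangent_vector M p \<phi> w"
  have v: "v \<in> tangent_space M p" "v \<phi> = w"
    unfolding v_def using tangent_vector_in_tangent_space[OF M \<phi>] tangent_vector_apply[OF M \<phi>] by auto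
  have "v \<noteq> (\<lambda>c. 0)" using v(2) \<open>norm w = 1\<close> by auto
  \<comment> \<open>As \<open>s \<circ> G\<close> vanishes at \<open>x0\<close>, its difference
    quotients are nonnegative multiples of cone points, and the cone is closed.\<close>
  have "DG w \<in> corner_cone N k l A"
  proof (rule closed_sequentially[OF closed_corner_cone])
    show "(\<lambda>i. ((s \<circ> G) (y i) - (s \<circ> G) x0) /\<^sub>R norm (y i - x0)) \<longlonglongrightarrow> DG w"
      using difference_quotient_tendsto[OF DsG y dir] .
    show "((s \<circ> G) (y i) - (s \<circ> G) x0) /\<^sub>R norm (y i - x0) \<in> corner_cone N k l A" for i
      unfolding sGx0 using sGz[of "r i"] by (auto simp: y_def intro!: corner_cone_scaleR)
  qed
  then have dgv: "deriv_map M N g p v \<in> inner_tangent_cone N k K q"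
    using inner_tangent_cone_iff[OF N ad] deriv_g_ts deriv_g v(2) by simp
  \<comment> \<open>\<open>Df w\<close> and \<open>\<nu> (DG w)\<close> are both nonpositive and sum
    to zero by the KKT equation, so \<open>Df w\<close> vanishes.\<close>
  have "Df w \<le> 0"
  proof (rule LIMSEQ_le_const2[OF difference_quotient_tendsto[OF Df y dir]])
    have "f\<phi> (y i) \<le> f\<phi> x0" for i
      using X(5)[of "r i"] by (simp add: f\<phi>_def y_def Xz x0_def inv\<phi> p\<phi>)
    then show "\<exists>N. \<forall>n\<ge>N. (f\<phi> (y n) - f\<phi> x0) /\<^sub>R norm (y n - x0) \<le> 0"
      by (simp add: mult_nonneg_nonpos)
  qed
  moreover have "\<nu> (DG w) \<le> 0"
    using polar[OF dgv] \<mu>\<nu>[OF deriv_g_ts] deriv_g v(2) by simp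
  ultimately have "deriv_function M f p v = 0"
    using kkt[of w] deriv_f v(2) by simp
  then have "v \<in> critical_cone M N k K f g p - {\<lambda>c. 0}"
    using v(1) dgv \<open>v \<noteq> (\<lambda>c. 0)\<close> by (simp add: critical_cone_def q_def)
  then have pos: "lagrangian_second_deriv M N k K f g p \<mu> v > 0"
    using assms(12) by blast

  \<comment> \<open>The Lagrangian along the sequence\<close>
  have "H (y i) \<le> H x0" for i
  proof -
    \<comment> \<open>The multiplier term is nonpositive at these feasible points and zero at
      \<open>p\<close>, so the inequality for \<open>f\<close> passes to the Lagrangian.\<close>
    have "\<mu> (S (g (X (r i)))) \<le> 0" using polar[OF cone] .
    moreover have "\<nu> ((s \<circ> G) x0) = 0"
      unfolding sGx0 using \<nu> by (simp add: linear_0 bounded_linear.linear)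
    then have "H x0 = f p"
      using Hx[OF T(2)] by (simp add: f\<phi>_def x0_def inv\<phi> p\<phi>)
    ultimately show ?thesis
      using X(5)[of "r i"] by (simp add: H_def y_def Xz lagrangian_def)
  qed
  from second_derivative_nonpos_of_sequence[OF C2H T stat y dir this]
  have "lagrangian_second_deriv M N k K f g p \<mu> v \<le> 0"
    unfolding lagrangian_second_deriv_def second_deriv_function_def Let_def
      q_def[symmetric] S_def[symmetric] \<phi>_def[symmetric] x0_def[symmetric] H_def[symmetric] v(2) .
  with pos show False by simp
qed

end
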